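(* Let $n\ge 1$. For every choice of pairwise different speeds $v_1,\dots,v_{n+1}$ (positive integers), there exists a time $t\in(0,1)$ such that, at time $t$, either there is a runner alone or there are four different runners that are almost alone.
   Context: For a real number $x$, $\|x\|$ denotes the distance from $x$ to the closest integer. There are $n+1$ runners, indexed by $1,\dots,n+1$, with speeds $v_1,\dots,v_{n+1}$. Runner $k$ is alone at time $t$ if $\|t(v_i-v_k)\|\ge \frac{1}{n+1}$ for every $i\ne k$. Runner $k$ is almost alone at time $t$ if there exists $j\ne k$ such that $\|t(v_i-v_k)\|\ge\frac{1}{n+1}$ for every $i\ne j,k$. *)

theory Defs
  imports Complex_Main
begin

text \<open>Distance to the closest integer; \<open>round x\<close> is a closest integer to \<open>x\<close> by
  \<open>round_diff_minimal\<close>, and the choice made at half-integers does not affect the distance.\<close>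

definition dist_int :: "real \<Rightarrow> real" where
  "dist_int x = \<bar>x - of_int (round x)\<bar>"

text \<open>The \<open>n + 1\<close> runners are the indices \<open>1, \<dots>, n + 1\<close>; values of \<open>v\<close> outside this range
  are irrelevant. Speeds are converted to reals before subtracting, so differences may be
  negative.\<close>

definition runners :: "nat \<Rightarrow> nat set" where
  "runners n = {1..n + 1}"

definition alone :: "nat \<Rightarrow> (nat \<Rightarrow> nat) \<Rightarrow> real \<Rightarrow> nat \<Rightarrow> bool" where
  "alone n v t k \<longleftrightarrow>
     (\<forall>i\<in>runners n. i \<noteq> k \<longrightarrow>
        dist_int (t * (real (v i) - real (v k))) \<ge> 1 / (real n + 1))"

definition almost_alone :: "nat \<Rightarrow> (nat \<Rightarrow> nat) \<Rightarrow> real \<Rightarrow> nat \<Rightarrow> bool" where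
  "almost_alone n v t k \<longleftrightarrow>
     (\<exists>j\<in>runners n. j \<noteq> k \<and>
        (\<forall>i\<in>runners n. i \<noteq> j \<and> i \<noteq> k \<longrightarrow>
           dist_int (t * (real (v i) - real (v k))) \<ge> 1 / (real n + 1)))"

end

theory Submission
  imports Defs
begin

text \<open>
  At a time \<open>t\<close>, join two runners by an edge when they are at distance less than \<open>1 / (n + 1)\<close>.
  A runner is alone iff it is an isolated vertex, and almost alone if its degree is at most one.
  At a uniformly random time each pair is an edge with probability \<open>2 / (n + 1)\<close>, so the expected
  number of edges is \<open>n\<close>, while at \<open>t = 0\<close> all \<open>n (n + 1) / 2 \<ge> n\<close> pairs are edges. Discarding
  that time, one finds a time in \<open>(0, 1)\<close> with fewer than \<open>n\<close> edges, so with degree sum at most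
  \<open>2 (n + 1) - 4\<close>; if no vertex is isolated, at least four of them must have degree one
  (\<open>four_leaves\<close>).

  The average is taken over the finitely many times \<open>j / N\<close> with \<open>0 < j < N\<close>, where
  \<open>N = D (n + 1)\<close> and \<open>D\<close> is a common multiple of all differences of speeds. For a pair whose
  speeds differ by \<open>d\<close>, the relative position is \<open>j / (c (n + 1))\<close> with \<open>c = D / d\<close>, so the times
  at which the pair is close are counted by residues modulo \<open>c (n + 1)\<close>
  (\<open>card_close_times\<close>). Since closeness is a strict inequality, the discrete count loses
  the boundary residues, and the average is strictly below \<open>n\<close> for every \<open>n \<ge> 1\<close>.
\<close>

section \<open>Distance to the closest integer\<close>

lemma dist_int_minus: "dist_int (- x) = dist_int x"
proof -
  have le: "dist_int (- y) \<le> dist_int y" for y :: real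
    using round_diff_minimal[of "- y" "- round y"] by (simp add: dist_int_def)
  show ?thesis using le[of x] le[of "- x"] by simp
qed

lemma dist_int_less_imp_residue:
  fixes c p j :: nat
  assumes "c \<ge> 1" "p \<ge> 1"
    and close: "dist_int (real j / real (c * p)) < 1 / real p"
  shows "j mod (c * p) < c \<or> c * p - c < j mod (c * p)"
proof -
  define m where "m = round (real j / real (c * p))"
  define r where "r = int j - m * int (c * p)"
  have pos: "real (c * p) > 0" using assms by simp
  have "\<bar>real j / real (c * p) - of_int m\<bar> * real (c * p) < 1 / real p * real (c * p)"
    using close pos unfolding dist_int_def m_def by (intro mult_strict_right_mono) auto
  moreover have "\<bar>real j / real (c * p) - of_int m\<bar> * real (c * p) = of_int \<bar>r\<bar>"
  proof -
    have "\<bar>real j / real (c * p) - of_int m\<bar> * real (c * p)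
        = \<bar>(real j / real (c * p) - of_int m) * real (c * p)\<bar>"
      using pos by (simp add: abs_mult)
    also have "(real j / real (c * p) - of_int m) * real (c * p) = of_int r"
      using assms(1,2) unfolding r_def by (simp add: left_diff_distrib)
    finally show ?thesis by simp
  qed
  moreover have "1 / real p * real (c * p) = of_int (int c)" using assms by simp
  ultimately have r: "\<bar>r\<bar> < int c" by (simp only: of_int_less_iff)
  have cp: "int c \<le> int (c * p)" using assms by simp
  have j: "int j = r + m * int (c * p)" by (simp add: r_def)
  have res: "int (j mod (c * p)) = r mod int (c * p)"
    by (simp only: zmod_int j mod_mult_self1)
  show ?thesis
  proof (cases "r \<ge> 0")
    case True
    then have "r mod int (c * p) = r" using r cp by (intro mod_pos_pos_trivial) linarith+
    then show ?thesis using res r by linarith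
  next
    case False
    have "r mod int (c * p) = (r + int (c * p)) mod int (c * p)" by simp
    also have "\<dots> = r + int (c * p)"
      using False r cp by (intro mod_pos_pos_trivial) linarith+
    finally show ?thesis using res r cp by linarith
  qed
qed

text \<open>
  Over \<open>d\<close> full periods of length \<open>c p\<close>, each period contributes the \<open>2 c - 1\<close> residues strictly
  within \<open>c\<close> of zero. That is \<open>2 c d - d\<close>, and one of them is \<open>j = 0\<close>.
\<close>

lemma card_close_times:
  fixes c d p :: nat
  assumes "c \<ge> 1" "d \<ge> 1" "p \<ge> 1"
  shows "card {j \<in> {1..<d * (c * p)}. dist_int (real j / real (c * p)) < 1 / real p}
           \<le> 2 * (c * d) - 2"
proof -
  let ?M = "c * p"
  let ?A = "{..<d} \<times> ({..<c} \<union> {?M - c<..<?M})"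
  let ?f = "\<lambda>(q, a). q * ?M + a"
  have fin: "finite ?A" by simp
  have sub: "{j \<in> {1..<d * ?M}. dist_int (real j / real ?M) < 1 / real p} \<subseteq> ?f ` ?A - {0}"
  proof
    fix j assume "j \<in> {j \<in> {1..<d * ?M}. dist_int (real j / real ?M) < 1 / real p}"
    then have j: "1 \<le> j" "j < d * ?M" and close: "dist_int (real j / real ?M) < 1 / real p"
      by auto
    have "j div ?M < d" using j(2) by (simp add: less_mult_imp_div_less)
    moreover have "j mod ?M < ?M" using assms by simp
    ultimately have "(j div ?M, j mod ?M) \<in> ?A"
      using dist_int_less_imp_residue[OF assms(1,3) close] by auto
    moreover have "?f (j div ?M, j mod ?M) = j" by (simp only: prod.case div_mult_mod_eq)
    ultimately have "j \<in> ?f ` ?A" by (metis image_eqI)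
    then show "j \<in> ?f ` ?A - {0}" using j(1) by simp
  qed
  have zero: "0 \<in> ?f ` ?A"
    using assms by (intro image_eqI[of _ _ "(0, 0)"]) auto
  have "card ({..<c} \<union> {?M - c<..<?M}) \<le> c + (c - 1)"
  proof -
    have "c \<le> ?M" using assms by simp
    then have "card {?M - c<..<?M} = c - 1" by simp
    then show ?thesis using card_Un_le[of "{..<c}" "{?M - c<..<?M}"] by simp
  qed
  then have "card ?A \<le> d * (c + (c - 1))" by (simp add: card_cartesian_product)
  then have image: "card (?f ` ?A) \<le> d * (c + (c - 1))"
    using card_image_le[OF fin, of ?f] by linarith
  have "d * (c + (c - 1)) + d = 2 * (c * d)"
    using assms(1) by (cases c) (simp_all add: algebra_simps)
  moreover have "card (?f ` ?A - {0}) = card (?f ` ?A) - 1"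
    using zero fin by (simp add: card_Diff_singleton)
  moreover have "card {j \<in> {1..<d * ?M}. dist_int (real j / real ?M) < 1 / real p}
      \<le> card (?f ` ?A - {0})"
    using sub fin by (intro card_mono) auto
  ultimately show ?thesis using image assms(2) by linarith
qed

lemma card_close_times_pair:
  fixes a b D p :: nat
  assumes "a \<noteq> b" "p \<ge> 1" "D \<ge> 1" and dvd: "nat \<bar>int a - int b\<bar> dvd D"
  shows "card {j \<in> {1..<D * p}.
            dist_int (real j / real (D * p) * (real a - real b)) < 1 / real p} \<le> 2 * D - 2"
proof -
  define d where "d = nat \<bar>int a - int b\<bar>"
  obtain c where c: "D = d * c" using dvd unfolding d_def by (elim dvdE)
  have d: "d \<ge> 1" using assms(1) unfolding d_def by linarith
  have c1: "c \<ge> 1" using c assms(3) by (cases c) auto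
  have eq: "dist_int (real j / real (D * p) * (real a - real b)) = dist_int (real j / real (c * p))"
    for j
  proof -
    have red: "real j / real (D * p) * real d = real j / real (c * p)"
      using d c1 assms(2) by (simp add: c)
    show ?thesis
    proof (cases "a \<ge> b")
      case True
      then have "real a - real b = real d" unfolding d_def by linarith
      then show ?thesis using red by (simp only:)
    next
      case False
      then have "real a - real b = - real d" unfolding d_def by linarith
      then show ?thesis using red by (simp only: mult_minus_right dist_int_minus)
    qed
  qed
  have Dp: "D * p = d * (c * p)" and Dc: "2 * (c * d) = 2 * D" by (simp_all add: c)
  show ?thesis using card_close_times[OF c1 d assms(2)] unfolding eq Dc unfolding Dp .
qed

section \<open>Sparse graphs without isolated vertices\<close>

lemma sum_degrees_eq:
  fixes R :: "nat set" and E :: "nat \<Rightarrow> nat \<Rightarrow> bool"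
  assumes fin: "finite R" and sym: "\<And>i k. E i k \<Longrightarrow> E k i"
  shows "(\<Sum>k\<in>R. card {i \<in> R. i \<noteq> k \<and> E i k}) = 2 * card {(i, k) \<in> R \<times> R. i < k \<and> E i k}"
proof -
  let ?U = "{(i, k) \<in> R \<times> R. i < k \<and> E i k}"
  let ?L = "{(i, k) \<in> R \<times> R. k < i \<and> E i k}"
  have finU: "finite ?U" by (rule finite_subset[of _ "R \<times> R"]) (use fin in auto)
  have L: "?L = prod.swap ` ?U" using sym by force
  have finL: "finite ?L" using finU L by simp
  have cardL: "card ?L = card ?U" unfolding L by (intro card_image) simp
  have "(\<Sum>k\<in>R. card {i \<in> R. i \<noteq> k \<and> E i k}) = card (SIGMA k:R. {i \<in> R. i \<noteq> k \<and> E i k})"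
    using fin by simp
  also have "(SIGMA k:R. {i \<in> R. i \<noteq> k \<and> E i k}) = ?U \<union> ?L" using sym by auto
  also have "card (?U \<union> ?L) = card ?U + card ?L"
    using finU finL by (intro card_Un_disjoint) auto
  finally show ?thesis using cardL by simp
qed

text \<open>
  Each vertex that is not a leaf contributes at least two to the degree sum and each leaf exactly
  one, so the degree sum, which is at most \<open>2 |R| - 4\<close>, is at least \<open>2 |R|\<close> minus the number of
  leaves. Counting edges and not just degrees matters: from a degree sum below \<open>2 |R| - 2\<close>, parity
  is what gives a fourth leaf.
\<close>

lemma four_leaves:
  fixes R :: "nat set" and E :: "nat \<Rightarrow> nat \<Rightarrow> bool"
  assumes fin: "finite R" and sym: "\<And>i k. E i k \<Longrightarrow> E k i"
    and few: "card {(i, k) \<in> R \<times> R. i < k \<and> E i k} + 2 \<le> card R"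
    and no_isolated: "\<And>k. k \<in> R \<Longrightarrow> \<exists>i\<in>R. i \<noteq> k \<and> E i k"
  shows "4 \<le> card {k \<in> R. card {i \<in> R. i \<noteq> k \<and> E i k} = 1}"
proof -
  let ?deg = "\<lambda>k. card {i \<in> R. i \<noteq> k \<and> E i k}"
  let ?leaves = "{k \<in> R. ?deg k = 1}"
  have "2 * card R = (\<Sum>k\<in>R. 2)" by simp
  also have "\<dots> \<le> (\<Sum>k\<in>R. ?deg k + (if ?deg k = 1 then 1 else 0))"
  proof (rule sum_mono)
    fix k assume "k \<in> R"
    then have "{i \<in> R. i \<noteq> k \<and> E i k} \<noteq> {}" using no_isolated by blast
    then have "?deg k > 0" using fin by (simp add: card_gt_0_iff)
    then show "2 \<le> ?deg k + (if ?deg k = 1 then 1 else 0)" by simp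
  qed
  also have "\<dots> = (\<Sum>k\<in>R. ?deg k) + card ?leaves"
    using fin by (simp add: sum.distrib sum.If_cases Int_def)
  also have "(\<Sum>k\<in>R. ?deg k) = 2 * card {(i, k) \<in> R \<times> R. i < k \<and> E i k}"
    using fin sym by (rule sum_degrees_eq)
  finally show ?thesis using few by linarith
qed

lemma card_ordered_pairs:
  fixes R :: "nat set"
  assumes "finite R"
  shows "2 * card {(i, k) \<in> R \<times> R. i < k} = card R * (card R - 1)"
proof -
  have "card {i \<in> R. i \<noteq> k} = card R - 1" if "k \<in> R" for k
  proof -
    have "{i \<in> R. i \<noteq> k} = R - {k}" by auto
    then show ?thesis using that assms by (simp add: card_Diff_singleton)
  qed
  then have "(\<Sum>k\<in>R. card {i \<in> R. i \<noteq> k}) = card R * (card R - 1)" by simp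
  then show ?thesis using sum_degrees_eq[OF assms, of "\<lambda>_ _. True"] by simp
qed

section \<open>A time with few close pairs\<close>

definition close :: "nat \<Rightarrow> (nat \<Rightarrow> nat) \<Rightarrow> real \<Rightarrow> nat \<Rightarrow> nat \<Rightarrow> bool" where
  "close n v t i k \<longleftrightarrow> dist_int (t * (real (v i) - real (v k))) < 1 / (real n + 1)"

lemma close_sym: "close n v t i k \<Longrightarrow> close n v t k i"
  using dist_int_minus[of "t * (real (v i) - real (v k))"]
  by (simp add: close_def algebra_simps)

text \<open>
  Double counting over the times \<open>j / N\<close>, \<open>0 < j < N = D (n + 1)\<close>. If each of these \<open>N - 1\<close> times had at
  least \<open>n\<close> close pairs, there would be at least \<open>n (D (n + 1) - 1)\<close> incidences, but
  \<open>card_close_times_pair\<close> allows only \<open>n (n + 1) / 2 * (2 D - 2) = n (D (n + 1) - (n + 1))\<close>.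
\<close>

lemma exists_time_few_close_pairs:
  fixes n :: nat and v :: "nat \<Rightarrow> nat"
  assumes n: "n \<ge> 1" and inj: "inj_on v (runners n)"
  shows "\<exists>t::real. 0 < t \<and> t < 1 \<and>
    card {(i, k) \<in> runners n \<times> runners n. i < k \<and> close n v t i k} < n"
proof (rule ccontr)
  assume neg: "\<not> ?thesis"
  let ?R = "runners n"
  let ?P = "{(i, k) \<in> ?R \<times> ?R. i < k}"
  have finR: "finite ?R" and cardR: "card ?R = n + 1" by (simp_all add: runners_def)
  have finP: "finite ?P" by (rule finite_subset[of _ "?R \<times> ?R"]) (use finR in auto)
  \<comment> \<open>Every difference of speeds is at most the sum of all speeds, so it divides this factorial.\<close>
  define D :: nat where "D = fact (sum v ?R)"
  have D: "D \<ge> 1" unfolding D_def by simp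
  let ?N = "D * (n + 1)"
  let ?T = "\<lambda>j. real j / real ?N"
  let ?C = "\<lambda>j x. close n v (?T j) (fst x) (snd x)"
  have lower: "n \<le> card {x \<in> ?P. ?C j x}" if "j \<in> {1..<?N}" for j
  proof -
    have "0 < real j" "real j < real ?N" using that by (simp, simp only: of_nat_less_iff) simp
    then have "0 < ?T j" "?T j < 1" by (simp_all only: divide_pos_pos divide_less_eq_1_pos)
    then have "n \<le> card {(i, k) \<in> ?R \<times> ?R. i < k \<and> close n v (?T j) i k}"
      using neg not_less by blast
    also have "{(i, k) \<in> ?R \<times> ?R. i < k \<and> close n v (?T j) i k} = {x \<in> ?P. ?C j x}" by auto
    finally show ?thesis .
  qed
  have upper: "card {j \<in> {1..<?N}. ?C j x} \<le> 2 * D - 2" if xP: "x \<in> ?P" for x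
  proof -
    obtain i k where x: "x = (i, k)" and ik: "i \<in> ?R" "k \<in> ?R" "i < k"
      using xP by blast
    have neq: "v i \<noteq> v k" using inj ik by (metis inj_onD less_irrefl)
    have "v i \<le> sum v ?R" "v k \<le> sum v ?R" using ik finR by (auto intro: member_le_sum)
    then have "nat \<bar>int (v i) - int (v k)\<bar> dvd D"
      unfolding D_def using neq by (intro dvd_fact) linarith+
    from card_close_times_pair[OF neq _ D this, of "n + 1"]
    show ?thesis unfolding close_def x by (simp add: add.commute)
  qed
  have "n * (?N - 1) = (\<Sum>j\<in>{1..<?N}. n)" by simp
  also have "\<dots> \<le> (\<Sum>j\<in>{1..<?N}. card {x \<in> ?P. ?C j x})" using lower by (rule sum_mono)
  also have "\<dots> = (\<Sum>x\<in>?P. card {j \<in> {1..<?N}. ?C j x})"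
    using finP by (intro sum_multicount_gen) auto
  also have "\<dots> \<le> (\<Sum>x\<in>?P. 2 * D - 2)" using upper by (rule sum_mono)
  also have "\<dots> = 2 * card ?P * (D - 1)" by (simp add: diff_mult_distrib2)
  also have "2 * card ?P = (n + 1) * n" using card_ordered_pairs[OF finR] cardR by simp
  finally have "n * (?N - 1) \<le> n * ((n + 1) * (D - 1))" by (simp only: ac_simps)
  then have "?N - 1 \<le> (n + 1) * (D - 1)" using n by simp
  moreover have "(n + 1) * (D - 1) + (n + 1) = ?N" using D by (cases D) (simp_all add: algebra_simps)
  ultimately show False using n by linarith
qed

theorem theorem6:
  fixes n :: nat and v :: "nat \<Rightarrow> nat"
  assumes "n \<ge> 1"
    and "\<forall>i\<in>runners n. v i > 0"
    and "inj_on v (runners n)"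
  shows "\<exists>t::real. 0 < t \<and> t < 1 \<and>
    ((\<exists>k\<in>runners n. alone n v t k) \<or>
     (\<exists>K. K \<subseteq> runners n \<and> card K = 4 \<and> (\<forall>k\<in>K. almost_alone n v t k)))"
proof -
  let ?R = "runners n"
  have finR: "finite ?R" and cardR: "card ?R = n + 1" by (simp_all add: runners_def)
  obtain t where t: "0 < t" "t < 1"
    and few: "card {(i, k) \<in> ?R \<times> ?R. i < k \<and> close n v t i k} < n"
    using exists_time_few_close_pairs[OF assms(1,3)] by blast
  let ?leaves = "{k \<in> ?R. card {i \<in> ?R. i \<noteq> k \<and> close n v t i k} = 1}"
  have "\<exists>K. K \<subseteq> ?R \<and> card K = 4 \<and> (\<forall>k\<in>K. almost_alone n v t k)"
    if not_alone: "\<not> (\<exists>k\<in>?R. alone n v t k)"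
  proof -
    have "\<exists>i\<in>?R. i \<noteq> k \<and> close n v t i k" if "k \<in> ?R" for k
      using not_alone that unfolding alone_def close_def by (meson not_le)
    then have "4 \<le> card ?leaves"
      using finR few cardR by (intro four_leaves) (auto intro: close_sym)
    then obtain K where K: "K \<subseteq> ?leaves" "card K = 4"
      by (rule obtain_subset_with_card_n)
    have "almost_alone n v t k" if "k \<in> K" for k
    proof -
      have "card {i \<in> ?R. i \<noteq> k \<and> close n v t i k} = 1" using K(1) that by auto
      then obtain j where "{i \<in> ?R. i \<noteq> k \<and> close n v t i k} = {j}"
        by (auto simp: card_1_singleton_iff)
      then have "j \<in> ?R" "j \<noteq> k" "\<forall>i\<in>?R. i \<noteq> j \<and> i \<noteq> k \<longrightarrow> \<not> close n v t i k" by blast+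
      then show ?thesis unfolding almost_alone_def close_def by (auto simp: not_less)
    qed
    then show ?thesis using K by blast
  qed
  then show ?thesis using t by blast
qed

end
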